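(* Let $J\in\mathcal{C}$ on $\mathcal{H}=\mathbb{R}^n$ be such that $K=\partial J(0)\subset\mathbb{R}^n$ is a convex polyhedron satisfying the following condition: for all $u\in\mathbb{R}^n$ the element $\hat p:=\arg\min\{\|q\|:q\in\partial J(u)\}$ satisfies $$\langle\hat p,\hat p-q\rangle=0\quad\forall q\in\partial J(u).$$ Then the gradient flow $\partial_tu=-p$, $p\in\partial J(u)$ with $u(0)=f$ yields a sequence of eigenvectors $p(t)$ for $t>0$, i.e. $p(t)\in\partial J(p(t))$ for all $t>0$. Furthermore, $t\mapsto p(t)$ takes only finitely many different values and there is $T>0$ such that $p(t)=0$ for all $t\ge T$.
   Context: The class $\mathcal{C}$ consists of all maps $J:\mathcal{H}\to\mathbb{R}\cup\{+\infty\}$ that are convex, lower semicontinuous, and absolutely one-homogeneous, i.e. $J(cu)=|c|J(u)$ for all $u\in\mathcal{H}$, $c\in\mathbb{R}\setminus\{0\}$, and $J(0)=0$. Here $\mathcal{H}=\mathbb{R}^n$ with the Euclidean inner product and norm. The subdifferential is $\partial J(u)=\{p\in\mathcal{H}:\langle p,v\rangle\le J(v)\ \forall v\in\mathcal{H},\ \langle p,u\rangle=J(u)\}$, and $\mathrm{dom}(\partial J)=\{u:\partial J(u)\ne\emptyset\}$. Gradient flow: for $f\in\overline{\mathrm{dom}(\partial J)}$, the solution $(u,p)$ of $\partial_tu(t)=-p(t)$, $p(t)\in\partial J(u(t))$, $u(0)=f$ is the unique continuous $u:[0,\infty)\to\mathcal{H}$ with $u(0)=f$ given by Brezis' theory (Lipschitz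 on $[\delta,\infty)$ for every $\delta>0$, $u(t)\in\mathrm{dom}(\partial J)$ for all $t>0$, right-differentiable at every $t>0$), together with $p(t):=-\partial_t^+u(t)$, which is the element of minimal norm in $\partial J(u(t))$ for every $t>0$. *)

theory Defs
  imports "HOL-Analysis.Analysis"
begin

text \<open>Functionals with values in the reals extended by \<open>+\<infinity>\<close> are functions to \<^typ>\<open>ereal\<close> that
  avoid \<open>-\<infinity>\<close>. The library's \<^const>\<open>convex_on\<close> covers only real-valued functions.\<close>

definition ereal_convex :: "('a::real_vector \<Rightarrow> ereal) \<Rightarrow> bool" where
  "ereal_convex J \<longleftrightarrow>
     (\<forall>u v. \<forall>\<theta>::real. 0 < \<theta> \<and> \<theta> < 1 \<longrightarrow>
        J (\<theta> *\<^sub>R u + (1 - \<theta>) *\<^sub>R v) \<le> ereal \<theta> * J u + ereal (1 - \<theta>) * J v)"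

definition lower_semicontinuous :: "('a::topological_space \<Rightarrow> ereal) \<Rightarrow> bool" where
  "lower_semicontinuous J \<longleftrightarrow> (\<forall>u. J u \<le> Liminf (at u) J)"

definition abs_one_homogeneous :: "('a::real_vector \<Rightarrow> ereal) \<Rightarrow> bool" where
  "abs_one_homogeneous J \<longleftrightarrow>
     (\<forall>u. \<forall>c::real. c \<noteq> 0 \<longrightarrow> J (c *\<^sub>R u) = ereal \<bar>c\<bar> * J u) \<and> J 0 = 0"

definition class_C :: "('a::real_normed_vector \<Rightarrow> ereal) set" where
  "class_C = {J. (\<forall>u. J u \<noteq> -\<infinity>) \<and> ereal_convex J \<and> lower_semicontinuous J \<and>
                 abs_one_homogeneous J}"

definition subdiff :: "('a::real_inner \<Rightarrow> ereal) \<Rightarrow> 'a \<Rightarrow> 'a set" where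
  "subdiff J u = {p. (\<forall>v. ereal (p \<bullet> v) \<le> J v) \<and> ereal (p \<bullet> u) = J u}"

definition dom_subdiff :: "('a::real_inner \<Rightarrow> ereal) \<Rightarrow> 'a set" where
  "dom_subdiff J = {u. subdiff J u \<noteq> {}}"

text \<open>The pair \<open>(u, p)\<close> is the gradient flow of \<open>J\<close> started at \<open>f\<close>: \<open>u\<close> is the strong solution of
  Brezis' theory and \<open>p\<close> is the negative of its right derivative. The functions are total, but only
  the values of \<open>u\<close> on \<open>[0,\<infinity>)\<close> and those of \<open>p\<close> on \<open>(0,\<infinity>)\<close> matter. That \<open>p t\<close> has minimal norm
  in \<open>subdiff J (u t)\<close> is a consequence of these conditions and hence not required.\<close>

definition gradient_flow ::
  "('a::real_inner \<Rightarrow> ereal) \<Rightarrow> 'a \<Rightarrow> (real \<Rightarrow> 'a) \<Rightarrow> (real \<Rightarrow> 'a) \<Rightarrow> bool" where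
  "gradient_flow J f u p \<longleftrightarrow>
     continuous_on {0..} u \<and> u 0 = f \<and>
     (\<forall>\<delta>>0. \<exists>L. L-lipschitz_on {\<delta>..} u) \<and>
     (\<forall>t>0. u t \<in> dom_subdiff J) \<and>
     (\<forall>t>0. (u has_vector_derivative - p t) (at_right t)) \<and>
     (\<forall>t>0. p t \<in> subdiff J (u t))"

end

theory Submission
  imports Defs
begin

text \<open>
  A lower semicontinuous one-homogeneous convex function is the support function of
  \<open>K = \<partial>J(0)\<close>, so \<open>\<partial>J(w)\<close> is the face of \<open>K\<close> on which the functional \<open>\<langle>\<cdot>, w\<rangle>\<close> is maximal
  (\<open>subdiff_eq_support_face\<close>). After this reduction everything is polyhedral geometry: \<open>K\<close> has only
  finitely many faces.

  \<^emph>\<open>Eigenvectors.\<close> Let \<open>p\<close> be the minimal element of the face exposed by \<open>w\<close>. Along the ray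
  \<open>w + r p\<close>, \<open>r \<ge> 0\<close>, the point \<open>p\<close> remains of minimal norm in the exposed face for as long as it
  belongs to it. If some point of \<open>K\<close> had a larger inner product with \<open>p\<close> than \<open>p\<close> itself, there
  would be a first \<open>r\<close> at which a vertex \<open>v\<close> (of \<open>K\<close> cut with a box) with \<open>\<langle>v, p\<rangle> > \<langle>p, p\<rangle>\<close> joins the
  exposed face, and this contradicts the orthogonality hypothesis at the point \<open>w + r p\<close>. Hence \<open>p\<close>
  maximises \<open>\<langle>\<cdot>, p\<rangle>\<close> on \<open>K\<close>, which says \<open>p \<in> \<partial>J(p)\<close> (\<open>minimal_element_is_eigenvector\<close>).

  \<^emph>\<open>Dynamics.\<close> Since there are finitely many faces, the face exposed by \<open>u(s)\<close> lies in the face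
  exposed by \<open>u(t)\<close> for \<open>s\<close> slightly larger than \<open>t\<close>. Let \<open>m\<close> be the minimal element of the latter.
  By orthogonality and monotonicity of the subdifferential, \<open>\<parallel>u(s) - u(t) + (s - t) m\<parallel>\<^sup>2\<close> has
  nonpositive right derivative, so \<open>u\<close> moves along the line with velocity \<open>- m\<close> for a while
  (\<open>locally_affine\<close>). In particular \<open>p(t) = m\<close>: all velocities are eigenvectors, and there are at
  most as many of them as faces.

  \<^emph>\<open>Extinction.\<close> The energy \<open>J(u(t)) = \<langle>p(t), u(t)\<rangle>\<close> is continuous, nonnegative by the symmetry
  of \<open>K\<close>, and has right derivative \<open>- \<parallel>p(t)\<parallel>\<^sup>2\<close>. If \<open>p\<close> never vanished, finiteness of its range would
  bound this rate away from zero and the energy would become negative. Once \<open>p\<close> vanishes the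
  flow is stationary (\<open>finite_extinction_time\<close>).
\<close>

section \<open>One-homogeneous functionals as support functions\<close>

definition support_face :: "'a::real_inner set \<Rightarrow> 'a \<Rightarrow> 'a set" where
  "support_face K w = {p \<in> K. \<forall>q\<in>K. q \<bullet> w \<le> p \<bullet> w}"

definition epigraph :: "('a \<Rightarrow> ereal) \<Rightarrow> ('a \<times> real) set" where
  "epigraph J = {(v, s). J v \<le> ereal s}"

lemma closed_epigraph:
  fixes J :: "'a::euclidean_space \<Rightarrow> ereal"
  assumes "lower_semicontinuous J"
  shows "closed (epigraph J)"
proof -
  have "\<forall>\<^sub>F y in nhds x. y \<in> - epigraph J" if "x \<in> - epigraph J" for x
  proof -
    obtain v s where x: "x = (v, s)" by (cases x)
    have "ereal s < J v" using that by (simp add: x epigraph_def not_le)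
    then obtain m where m: "ereal s < ereal m" "ereal m < J v"
      using ereal_dense2 by blast
    have "ereal m < Liminf (at v) J"
      using m(2) assms unfolding lower_semicontinuous_def by (metis order_less_le_trans)
    then have "\<forall>\<^sub>F y in at v. ereal m < J y" by (rule less_LiminfD)
    then have 1: "\<forall>\<^sub>F y in nhds v. ereal m < J y"
      unfolding eventually_at_filter by (rule eventually_mono) (use m(2) in auto)
    have 2: "\<forall>\<^sub>F r in nhds s. r < m"
      using m(1) eventually_nhds_in_open[of "{..<m}" s] by simp
    have "\<forall>\<^sub>F y in nhds v \<times>\<^sub>F nhds s. ereal m < J (fst y) \<and> snd y < m"
      by (rule eventually_prodI[OF 1 2])
    then show ?thesis
      unfolding x nhds_prod
      by (rule eventually_mono)
        (fastforce simp: epigraph_def dest: order_less_le_trans)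
  qed
  then have "\<forall>x\<in>- epigraph J. \<exists>T. open T \<and> x \<in> T \<and> T \<subseteq> - epigraph J"
    by (simp add: eventually_nhds subset_eq)
  then have "open (- epigraph J)" by (subst open_subopen)
  then show ?thesis by (simp add: closed_def)
qed

lemma convex_epigraph:
  assumes "ereal_convex J"
  shows "convex (epigraph J)"
  unfolding convex_alt
proof (intro ballI allI impI)
  fix x y and \<theta> :: real
  assume "x \<in> epigraph J" "y \<in> epigraph J" and \<theta>: "0 \<le> \<theta> \<and> \<theta> \<le> 1"
  then obtain v s w r where xy: "x = (v, s)" "y = (w, r)" "J v \<le> ereal s" "J w \<le> ereal r"
    by (auto simp: epigraph_def)
  show "(1 - \<theta>) *\<^sub>R x + \<theta> *\<^sub>R y \<in> epigraph J"
  proof (cases "\<theta> = 0 \<or> \<theta> = 1")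
    case True
    then show ?thesis using \<open>x \<in> epigraph J\<close> \<open>y \<in> epigraph J\<close> by auto
  next
    case False
    then have \<theta>': "0 < \<theta>" "\<theta> < 1" using \<theta> by auto
    have "J (\<theta> *\<^sub>R w + (1 - \<theta>) *\<^sub>R v) \<le> ereal \<theta> * J w + ereal (1 - \<theta>) * J v"
      using assms \<theta>' by (simp add: ereal_convex_def)
    also have "\<dots> \<le> ereal \<theta> * ereal r + ereal (1 - \<theta>) * ereal s"
      using \<theta>' xy by (intro add_mono ereal_mult_left_mono) auto
    finally show ?thesis by (simp add: xy epigraph_def add.commute)
  qed
qed

text \<open>Strict separation of a point below the graph from the epigraph, which is a closed convex cone,
  yields either an element of the subdifferential at zero that violates the bound, or, when the
  separating hyperplane is vertical, a direction in which that subdifferential is unbounded.\<close>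

lemma support_function_upper_bound:
  fixes J :: "'a::euclidean_space \<Rightarrow> ereal"
  assumes J: "J \<in> class_C" and p0: "p0 \<in> subdiff J 0"
    and bound: "\<And>q. q \<in> subdiff J 0 \<Longrightarrow> q \<bullet> w \<le> c"
  shows "J w \<le> ereal c"
proof (rule ccontr)
  assume "\<not> J w \<le> ereal c"
  then have "(w, c) \<notin> epigraph J" by (simp add: epigraph_def)
  moreover have "convex (epigraph J)" "closed (epigraph J)"
    using J closed_epigraph convex_epigraph by (auto simp: class_C_def)
  ultimately obtain A b where A: "A \<bullet> (w, c) < b" "\<And>x. x \<in> epigraph J \<Longrightarrow> b < A \<bullet> x"
    using separating_hyperplane_closed_point by metis
  obtain a \<beta> where "A = (a, \<beta>)" by (cases A)
  with A have sep: "a \<bullet> w + \<beta> * c < b" "\<And>v s. J v \<le> ereal s \<Longrightarrow> b < a \<bullet> v + \<beta> * s"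
    by (auto simp: epigraph_def inner_prod_def)
  have hom: "J (r *\<^sub>R v) = ereal \<bar>r\<bar> * J v" if "r \<noteq> 0" for r v
    using J that by (simp add: class_C_def abs_one_homogeneous_def)
  have J0: "J 0 = 0"
    using J by (simp add: class_C_def abs_one_homogeneous_def)
  have b: "b < 0" using sep(2)[of 0 0] J0 by simp
  have cone: "0 \<le> a \<bullet> v + \<beta> * s" if v: "J v \<le> ereal s" for v s
  proof (rule ccontr)
    assume neg: "\<not> ?thesis"
    \<comment> \<open>Scaling by \<open>r\<close> moves the point of the cone onto the separating hyperplane.\<close>
    define r where "r = b / (a \<bullet> v + \<beta> * s)"
    have r: "0 < r" using neg b by (simp add: r_def divide_neg_neg)
    have "J (r *\<^sub>R v) \<le> ereal r * ereal s"
      using hom[of r v] r ereal_mult_left_mono[OF v, of "ereal r"] by simp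
    then have "b < r * (a \<bullet> v + \<beta> * s)"
      using sep(2)[of "r *\<^sub>R v" "r * s"] by (simp add: algebra_simps)
    then show False using neg by (simp add: r_def)
  qed
  have "\<beta> \<ge> 0" using cone[of 0 1] J0 by simp
  have Kiff: "p \<in> subdiff J 0 \<longleftrightarrow> (\<forall>v. ereal (p \<bullet> v) \<le> J v)" for p
    by (simp add: subdiff_def J0)
  have in_K: "p \<in> subdiff J 0" if "\<And>v s. J v = ereal s \<Longrightarrow> p \<bullet> v \<le> s" for p
    unfolding Kiff
  proof
    fix v show "ereal (p \<bullet> v) \<le> J v"
      using J that[of v] by (cases "J v") (auto simp: class_C_def)
  qed
  show False
  proof (cases "\<beta> = 0")
    case False
    with \<open>\<beta> \<ge> 0\<close> have \<beta>: "\<beta> > 0" by simp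
    have "- (1 / \<beta>) *\<^sub>R a \<in> subdiff J 0"
    proof (rule in_K)
      fix v s assume "J v = ereal s"
      then have "0 \<le> a \<bullet> v + \<beta> * s" using cone[of v s] by simp
      then show "- (1 / \<beta>) *\<^sub>R a \<bullet> v \<le> s" using \<beta> by (simp add: field_simps)
    qed
    from bound[OF this] show False using sep(1) b \<beta> by (simp add: field_simps)
  next
    case True
    have aw: "a \<bullet> w < 0" using sep(1) b True by simp
    \<comment> \<open>The hyperplane is vertical: \<open>- a\<close> is a recession direction of \<open>subdiff J 0\<close> along
      which the inner product with \<open>w\<close> grows, and \<open>l\<close> is a multiple that exceeds the bound \<open>c\<close>.\<close>
    define l where "l = (\<bar>c - p0 \<bullet> w\<bar> + 1) / - (a \<bullet> w)"
    have l: "l \<ge> 0" using aw by (simp add: l_def divide_nonneg_pos del: divide_minus_right)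
    have "p0 - l *\<^sub>R a \<in> subdiff J 0"
    proof (rule in_K)
      fix v s assume v: "J v = ereal s"
      have "0 \<le> a \<bullet> v" using cone[of v s] v True by simp
      moreover have "p0 \<bullet> v \<le> s" using p0 v Kiff by (metis ereal_less_eq(3))
      ultimately show "(p0 - l *\<^sub>R a) \<bullet> v \<le> s"
        using l by (simp add: inner_diff_left) (meson diff_le_eq add_increasing2 mult_nonneg_nonneg)
    qed
    from bound[OF this] have "p0 \<bullet> w - l * (a \<bullet> w) \<le> c" by (simp add: inner_diff_left)
    moreover have "l * (a \<bullet> w) = - (\<bar>c - p0 \<bullet> w\<bar> + 1)" using aw by (simp add: l_def)
    ultimately show False by linarith
  qed
qed

text \<open>The right-hand side depends on \<^term>\<open>J\<close> only through \<^term>\<open>subdiff J 0\<close>. Its nontrivial part is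
  that a maximiser over that set attains the value of \<^term>\<open>J\<close>, which is biconjugation.\<close>

lemma subdiff_eq_support_face:
  fixes J :: "'a::euclidean_space \<Rightarrow> ereal"
  assumes J: "J \<in> class_C"
  shows "subdiff J w = support_face (subdiff J 0) w"
proof
  have J0: "J 0 = 0"
    using J by (simp add: class_C_def abs_one_homogeneous_def)
  show "subdiff J w \<subseteq> support_face (subdiff J 0) w"
  proof
    fix p assume p: "p \<in> subdiff J w"
    then have "q \<bullet> w \<le> p \<bullet> w" if "q \<in> subdiff J 0" for q
    proof -
      have "ereal (q \<bullet> w) \<le> J w" using that by (simp add: subdiff_def)
      also have "J w = ereal (p \<bullet> w)" using p by (simp add: subdiff_def)
      finally show ?thesis by simp
    qed
    then show "p \<in> support_face (subdiff J 0) w"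
      using p J0 by (simp add: support_face_def subdiff_def)
  qed
  show "support_face (subdiff J 0) w \<subseteq> subdiff J w"
  proof
    fix p assume p: "p \<in> support_face (subdiff J 0) w"
    then have "J w \<le> ereal (p \<bullet> w)"
      by (intro support_function_upper_bound[OF J, of p]) (auto simp: support_face_def)
    then show "p \<in> subdiff J w"
      using p by (auto simp: support_face_def subdiff_def intro: antisym)
  qed
qed

lemma uminus_mem_subdiff_0:
  assumes "J \<in> class_C" "p \<in> subdiff J 0"
  shows "- p \<in> subdiff J 0"
proof -
  have "J (- v) = J v" for v
  proof -
    have "c \<noteq> 0 \<Longrightarrow> J (c *\<^sub>R v) = ereal \<bar>c\<bar> * J v" for c
      using assms(1) by (simp add: class_C_def abs_one_homogeneous_def)
    from this[of "-1"] show ?thesis by (simp flip: one_ereal_def)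
  qed
  moreover have "ereal (p \<bullet> (- v)) \<le> J (- v)" for v
    using assms(2) unfolding subdiff_def by (simp del: inner_minus_right)
  ultimately show ?thesis
    using assms by (simp add: subdiff_def class_C_def abs_one_homogeneous_def)
qed

section \<open>Faces of polyhedra exposed by a functional\<close>

lemma support_face_face_of:
  fixes K :: "'a::real_inner set"
  assumes "convex K"
  shows "support_face K w face_of K"
proof (cases "support_face K w = {}")
  case False
  then obtain p where p: "p \<in> K" "\<And>q. q \<in> K \<Longrightarrow> q \<bullet> w \<le> p \<bullet> w"
    by (auto simp: support_face_def)
  then have "support_face K w = K \<inter> {q. w \<bullet> q = w \<bullet> p}"
    by (auto simp: support_face_def inner_commute intro: antisym)
  also have "\<dots> face_of K"
    by (rule face_of_Int_supporting_hyperplane_le) (use p assms in \<open>auto simp: inner_commute\<close>)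
  finally show ?thesis .
qed simp

lemma finite_support_faces:
  fixes K :: "'a::euclidean_space set"
  assumes "polyhedron K"
  shows "finite (range (support_face K))"
  by (rule finite_subset[OF _ finite_polyhedron_faces[OF assms]])
    (auto intro: support_face_face_of polyhedron_imp_convex assms)

lemma support_face_closed_convex:
  fixes K :: "'a::euclidean_space set"
  assumes "polyhedron K"
  shows "closed (support_face K w)" "convex (support_face K w)"
proof -
  have "polyhedron (support_face K w)"
    using assms face_of_polyhedron_polyhedron polyhedron_imp_convex support_face_face_of by blast
  then show "closed (support_face K w)" "convex (support_face K w)"
    by (auto intro: polyhedron_imp_closed polyhedron_imp_convex)
qed

text \<open>Upper semicontinuity of the exposed face: a face that is not contained in the limiting one has a
  point that is strictly beaten at \<^term>\<open>w\<close>, hence also nearby. Only finitely many faces have to be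
  excluded in this way, so one neighbourhood serves for all of them.\<close>

lemma eventually_support_face_subset:
  fixes K :: "'a::euclidean_space set"
  assumes "polyhedron K" and lim: "(u \<longlongrightarrow> w) F" and ne: "support_face K w \<noteq> {}"
  shows "\<forall>\<^sub>F s in F. support_face K (u s) \<subseteq> support_face K w"
proof -
  obtain p where p: "p \<in> support_face K w" using ne by blast
  define B where "B = {G \<in> range (support_face K). \<not> G \<subseteq> support_face K w}"
  have "finite B" using finite_support_faces[OF assms(1)] by (simp add: B_def)
  moreover have "\<forall>\<^sub>F s in F. support_face K (u s) \<noteq> G" if "G \<in> B" for G
  proof -
    obtain q where q: "q \<in> G" "q \<notin> support_face K w" using \<open>G \<in> B\<close> by (auto simp: B_def)
    have "q \<in> K" using q \<open>G \<in> B\<close> by (auto simp: B_def support_face_def)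
    then have lt: "q \<bullet> w < p \<bullet> w"
      using q(2) p by (auto simp: support_face_def)
    have "((\<lambda>s. p \<bullet> u s - q \<bullet> u s) \<longlongrightarrow> p \<bullet> w - q \<bullet> w) F"
      by (intro tendsto_intros lim)
    then have "\<forall>\<^sub>F s in F. 0 < p \<bullet> u s - q \<bullet> u s"
      using lt by (intro order_tendstoD) auto
    then show ?thesis
      by (rule eventually_mono) (use q p in \<open>force simp: support_face_def\<close>)
  qed
  ultimately have "\<forall>\<^sub>F s in F. \<forall>G\<in>B. support_face K (u s) \<noteq> G"
    by (simp add: eventually_ball_finite_distrib)
  then show ?thesis by (rule eventually_mono) (auto simp: B_def)
qed

text \<open>Maximality of a linear functional on a convex set is a local property, so it can be tested on the
  intersection with a box around the point. This intersection is a polytope even if \<^term>\<open>K\<close> is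
  unbounded, and the finitely many points that span it form a test set.\<close>

lemma polyhedron_finite_local_test_set:
  fixes K :: "'a::euclidean_space set"
  assumes K: "polyhedron K" and p: "p \<in> K"
  obtains V where "finite V" "V \<subseteq> K"
    "\<And>x. (\<And>v. v \<in> V \<Longrightarrow> v \<bullet> x \<le> p \<bullet> x) \<Longrightarrow> p \<in> support_face K x"
proof -
  have "polytope (K \<inter> cbox (p - One) (p + One))"
    by (intro polyhedron_Int_polytope K polytope_interval)
  then obtain V where V: "finite V" "K \<inter> cbox (p - One) (p + One) = convex hull V"
    unfolding polytope_def by blast
  show ?thesis
  proof
    show "finite V" "V \<subseteq> K" using V hull_subset[of V convex] by auto
    fix x assume x: "\<And>v. v \<in> V \<Longrightarrow> v \<bullet> x \<le> p \<bullet> x"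
    have "convex hull V \<subseteq> {z. x \<bullet> z \<le> x \<bullet> p}"
      by (intro hull_minimal convex_halfspace_le) (use x in \<open>auto simp: inner_commute\<close>)
    then have box: "z \<bullet> x \<le> p \<bullet> x" if "z \<in> K" "z \<in> cbox (p - One) (p + One)" for z
      using that V by (auto simp: inner_commute)
    have "q \<bullet> x \<le> p \<bullet> x" if q: "q \<in> K" for q
    proof -
      \<comment> \<open>Shrink \<open>q\<close> towards \<open>p\<close> until it lies in the box.\<close>
      define l where "l = 1 / (1 + norm (q - p))"
      have "0 < 1 + norm (q - p)" by (simp add: add_pos_nonneg)
      then have l: "0 < l" "l \<le> 1" "l * norm (q - p) \<le> 1" by (auto simp: l_def field_simps)
      have "(1 - l) *\<^sub>R p + l *\<^sub>R q \<in> K"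
        using polyhedron_imp_convex[OF K] p q l by (intro convexD) auto
      moreover have "\<bar>l * ((q - p) \<bullet> i)\<bar> \<le> 1" if "i \<in> Basis" for i
      proof -
        have "\<bar>l * ((q - p) \<bullet> i)\<bar> \<le> l * norm (q - p)"
          using l Basis_le_norm[OF that] by (simp add: abs_mult)
        with l show ?thesis by simp
      qed
      then have "(1 - l) *\<^sub>R p + l *\<^sub>R q \<in> cbox (p - One) (p + One)"
        by (auto simp: mem_box algebra_simps abs_le_iff)
      ultimately have "((1 - l) *\<^sub>R p + l *\<^sub>R q) \<bullet> x \<le> p \<bullet> x" by (rule box)
      then have "l * (q \<bullet> x) \<le> l * (p \<bullet> x)" by (simp add: algebra_simps inner_add_left)
      with l show ?thesis by simp
    qed
    then show "p \<in> support_face K x" using p by (simp add: support_face_def)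
  qed
qed

section \<open>Minimal elements of faces are eigenvectors\<close>

definition minimal_elements_orthogonal :: "'a::real_inner set \<Rightarrow> bool" where
  "minimal_elements_orthogonal K \<longleftrightarrow>
     (\<forall>w p. is_arg_min norm (\<lambda>q. q \<in> support_face K w) p \<longrightarrow>
        (\<forall>q\<in>support_face K w. p \<bullet> (p - q) = 0))"

lemma minimal_element_orthogonalD:
  assumes "minimal_elements_orthogonal K"
    and "is_arg_min norm (\<lambda>q. q \<in> support_face K w) p" "q \<in> support_face K w"
  shows "p \<bullet> q = p \<bullet> p"
  using assms unfolding minimal_elements_orthogonal_def by (fastforce simp: inner_diff_right)

text \<open>A point \<open>q\<close> that ties with \<open>p\<close> at \<open>w + r p\<close> but is beaten at \<open>w\<close> has made up for this along \<open>p\<close>, so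
  \<open>\<langle>q, p\<rangle> > \<langle>p, p\<rangle>\<close>, and by Cauchy-Schwarz \<open>q\<close> is longer than \<open>p\<close>.\<close>

lemma is_arg_min_along_ray:
  assumes min: "is_arg_min norm (\<lambda>q. q \<in> support_face K w) p" and r: "0 \<le> r"
    and p: "p \<in> support_face K (w + r *\<^sub>R p)"
  shows "is_arg_min norm (\<lambda>q. q \<in> support_face K (w + r *\<^sub>R p)) p"
  unfolding is_arg_min_linorder
proof (intro conjI allI impI p)
  fix q assume q: "q \<in> support_face K (w + r *\<^sub>R p)"
  have pw: "p \<in> support_face K w" "\<And>q. q \<in> support_face K w \<Longrightarrow> norm p \<le> norm q"
    using min by (auto simp: is_arg_min_linorder)
  have eq: "q \<bullet> w + r * (q \<bullet> p) = p \<bullet> w + r * (p \<bullet> p)"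
    using p q by (auto simp: support_face_def inner_add_right intro: antisym)
  have le: "q \<bullet> w \<le> p \<bullet> w" using pw(1) q by (auto simp: support_face_def)
  show "norm p \<le> norm q"
  proof (cases "q \<in> support_face K w")
    case True
    then show ?thesis by (rule pw)
  next
    case False
    then have "q \<bullet> w < p \<bullet> w"
      using le pw(1) q by (auto simp: support_face_def intro: order_trans)
    then have "r * (p \<bullet> p) < r * (q \<bullet> p)" using eq by linarith
    then have "p \<bullet> p < q \<bullet> p" using r by (simp add: mult_less_cancel_left)
    also have "\<dots> \<le> norm q * norm p" by (rule norm_cauchy_schwarz)
    finally have "norm p * norm p < norm q * norm p"
      by (simp add: norm_eq_square power2_eq_square flip: power2_norm_eq_inner)
    then show ?thesis by (simp add: mult_less_cancel_right)
  qed
qed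

text \<open>If \<open>p\<close> failed to maximise \<open>\<langle>\<cdot>, p\<rangle>\<close>, some test point would overtake it when \<open>w\<close> is moved in
  direction \<open>p\<close>. At the first tie the test point and \<open>p\<close> lie in a common exposed face whose minimal
  element is still \<open>p\<close>, and there orthogonality forbids the overtaking.\<close>

lemma minimal_element_is_eigenvector:
  fixes K :: "'a::euclidean_space set"
  assumes K: "polyhedron K" and orth: "minimal_elements_orthogonal K"
    and min: "is_arg_min norm (\<lambda>q. q \<in> support_face K w) p"
  shows "p \<in> support_face K p"
proof -
  have pw: "p \<in> K" "\<And>q. q \<in> K \<Longrightarrow> q \<bullet> w \<le> p \<bullet> w"
    using min by (auto simp: is_arg_min_linorder support_face_def)
  obtain V where V: "finite V" "V \<subseteq> K"
    and test: "\<And>x. (\<And>v. v \<in> V \<Longrightarrow> v \<bullet> x \<le> p \<bullet> x) \<Longrightarrow> p \<in> support_face K x"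
    using polyhedron_finite_local_test_set[OF K pw(1)] by metis
  define B where "B = {v \<in> V. p \<bullet> p < v \<bullet> p}"
  have "B = {}"
  proof (rule ccontr)
    assume "B \<noteq> {}"
    \<comment> \<open>The parameter \<open>r\<close> at which \<open>v\<close> ties with \<open>p\<close> on the ray \<open>w + r p\<close>.\<close>
    define \<rho> where "\<rho> v = (p \<bullet> w - v \<bullet> w) / (v \<bullet> p - p \<bullet> p)" for v
    have "finite B" using V by (simp add: B_def)
    then obtain v where v: "v \<in> B" "\<And>v'. v' \<in> B \<Longrightarrow> \<rho> v \<le> \<rho> v'"
      using \<open>B \<noteq> {}\<close> by (metis arg_min_if_finite(1) arg_min_least)
    have \<rho>: "0 \<le> \<rho> v'" if "v' \<in> B" for v'
      using that V pw(2) by (auto simp: \<rho>_def B_def intro!: divide_nonneg_pos)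
    have "p \<in> support_face K (w + \<rho> v *\<^sub>R p)"
    proof (rule test)
      fix v' assume v': "v' \<in> V"
      have 1: "v' \<bullet> w \<le> p \<bullet> w" using v' V pw(2) by auto
      have "\<rho> v * (v' \<bullet> p - p \<bullet> p) \<le> p \<bullet> w - v' \<bullet> w"
      proof (cases "v' \<in> B")
        case True
        then have "\<rho> v \<le> \<rho> v'" by (rule v)
        with True show ?thesis by (simp add: \<rho>_def[of v'] B_def pos_le_divide_eq)
      next
        case False
        then have "\<rho> v * (v' \<bullet> p - p \<bullet> p) \<le> 0"
          using \<rho>[OF v(1)] v' by (auto simp: B_def intro: mult_nonneg_nonpos)
        with 1 show ?thesis by linarith
      qed
      then show "v' \<bullet> (w + \<rho> v *\<^sub>R p) \<le> p \<bullet> (w + \<rho> v *\<^sub>R p)"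
        by (simp add: inner_add_right algebra_simps)
    qed
    moreover have "v \<bullet> (w + \<rho> v *\<^sub>R p) = p \<bullet> (w + \<rho> v *\<^sub>R p)"
    proof -
      have "\<rho> v * (v \<bullet> p - p \<bullet> p) = p \<bullet> w - v \<bullet> w" using v(1) by (simp add: \<rho>_def B_def)
      then show ?thesis by (simp add: inner_add_right algebra_simps)
    qed
    ultimately have "v \<in> support_face K (w + \<rho> v *\<^sub>R p)" "p \<in> support_face K (w + \<rho> v *\<^sub>R p)"
      using v(1) V(2) by (auto simp: support_face_def B_def)
    then have "p \<bullet> v = p \<bullet> p"
      using minimal_element_orthogonalD[OF orth] is_arg_min_along_ray[OF min \<rho>[OF v(1)]] by blast
    then show False using v(1) by (simp add: B_def inner_commute)
  qed
  then show ?thesis by (intro test) (auto simp: B_def not_less)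
qed

section \<open>Functions determined by right derivatives\<close>

text \<open>Relax the slope to \<open>c + e\<close>. By compactness there is a last point at which the graph is not above
  the line of this slope through its initial point; unless it is the right endpoint, the
  derivative there keeps the graph below the line a little longer.\<close>

lemma right_derivative_upper_bound:
  fixes g :: "real \<Rightarrow> real"
  assumes "a \<le> b" and cont: "continuous_on {a..b} g"
    and der: "\<And>t. a \<le> t \<Longrightarrow> t < b \<Longrightarrow> (g has_real_derivative g' t) (at_right t)"
    and le: "\<And>t. a \<le> t \<Longrightarrow> t < b \<Longrightarrow> g' t \<le> c"
  shows "g b \<le> g a + c * (b - a)"
proof -
  have *: "g b \<le> g a + (c + e) * (b - a)" if "e > 0" for e
  proof -
    define h where "h s = g s - (c + e) * (s - a)" for s
    define S where "S = {s \<in> {a..b}. h s \<le> h a}"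
    have "continuous_on {a..b} h" unfolding h_def by (intro continuous_intros cont)
    then have "closed ({a..b} \<inter> h -` {..h a})" by (intro continuous_closed_preimage) auto
    moreover have "{a..b} \<inter> h -` {..h a} = S" by (auto simp: S_def)
    ultimately have "closed S" by simp
    moreover have "bounded S" unfolding S_def by (rule bounded_subset[of "{a..b}"]) auto
    ultimately have "compact S" by (simp add: compact_eq_bounded_closed)
    moreover have "a \<in> S" using \<open>a \<le> b\<close> by (simp add: S_def)
    ultimately obtain t where t: "t \<in> S" "\<And>s. s \<in> S \<Longrightarrow> s \<le> t"
      using compact_attains_sup[of S] by auto
    have "t = b"
    proof (rule ccontr)
      assume "t \<noteq> b"
      with t have tb: "a \<le> t" "t < b" by (auto simp: S_def)
      have "(h has_real_derivative g' t - (c + e)) (at_right t)"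
        unfolding h_def by (rule derivative_eq_intros der tb | simp)+
      moreover have "g' t - (c + e) < 0" using le[OF tb] \<open>e > 0\<close> by simp
      ultimately obtain d where d: "d > 0" "\<And>x. 0 < x \<Longrightarrow> t + x \<in> {t<..} \<Longrightarrow> x < d \<Longrightarrow> h (t + x) < h t"
        using has_real_derivative_neg_dec_right by blast
      define x where "x = min (d / 2) (b - t)"
      have x: "0 < x" "x < d" "t + x \<le> b" using d(1) tb by (auto simp: x_def min_def)
      have "t + x \<in> S" using d(2)[of x] x t(1) tb by (auto simp: S_def)
      then show False using t(2) x by fastforce
    qed
    then have "h b \<le> h a" using t(1) by (simp add: S_def)
    then show ?thesis by (simp add: h_def)
  qed
  show ?thesis
  proof (cases "a = b")
    case False
    then have ab: "a < b" using assms by simp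
    show ?thesis
    proof (rule field_le_epsilon)
      fix e :: real assume "e > 0"
      then have "g b \<le> g a + (c + e / (b - a)) * (b - a)" using ab by (intro *) simp
      then show "g b \<le> g a + c * (b - a) + e" using ab by (simp add: distrib_right)
    qed
  qed simp
qed

text \<open>The filter \<^term>\<open>at_right t\<close> ignores \<^term>\<open>t\<close>, but the derivative does depend on the value there,
  so the functions have to agree on a half-open interval that contains \<^term>\<open>t\<close>.\<close>

lemma right_derivative_cong:
  fixes f :: "real \<Rightarrow> 'a::real_normed_vector"
  assumes "t < b" "\<And>s. t \<le> s \<Longrightarrow> s < b \<Longrightarrow> g s = f s"
    and "(f has_vector_derivative D) (at_right t)"
  shows "(g has_vector_derivative D) (at_right t)"
proof -
  have "(f has_vector_derivative D) (at t within {t..})"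
    using assms(3) by (simp add: at_within_Ici_at_right)
  then have "(g has_vector_derivative D) (at t within {t..})"
    by (rule has_vector_derivative_transform_within[of _ _ _ _ "b - t"])
      (use assms(1,2) in \<open>auto simp: dist_real_def\<close>)
  then show ?thesis by (simp add: at_within_Ici_at_right)
qed

section \<open>Gradient flows of polyhedral support functions\<close>

lemma support_face_monotone:
  assumes "p \<in> support_face K v" "q \<in> support_face K w"
  shows "0 \<le> (p - q) \<bullet> (v - w)"
proof -
  have "q \<bullet> v \<le> p \<bullet> v" "p \<bullet> w \<le> q \<bullet> w" using assms by (auto simp: support_face_def)
  then show ?thesis by (simp add: algebra_simps inner_diff_left inner_diff_right)
qed

lemma closest_point_is_arg_min:
  fixes S :: "'a::euclidean_space set"
  assumes "closed S" "S \<noteq> {}"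
  shows "is_arg_min norm (\<lambda>q. q \<in> S) (closest_point S 0)"
  using closest_point_exists[OF assms, of 0] by (simp add: is_arg_min_linorder)

text \<open>The gradient flow expressed through the faces of \<^term>\<open>K\<close> alone, without the functional of which
  \<^term>\<open>K\<close> is the subdifferential at zero.\<close>

locale polyhedral_flow =
  fixes K :: "'a::euclidean_space set" and u p :: "real \<Rightarrow> 'a"
  assumes polyhedron: "polyhedron K"
    and orthogonal: "minimal_elements_orthogonal K"
    and continuous: "continuous_on {0<..} u"
    and derivative: "\<And>t. 0 < t \<Longrightarrow> (u has_vector_derivative - p t) (at_right t)"
    and inclusion: "\<And>t. 0 < t \<Longrightarrow> p t \<in> support_face K (u t)"
begin

lemma derivative_sq_dist_affine:
  assumes "0 < r"
  shows "((\<lambda>r. (u r - a + (r - t) *\<^sub>R m) \<bullet> (u r - a + (r - t) *\<^sub>R m)) has_real_derivative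
           2 * ((m - p r) \<bullet> (u r - a + (r - t) *\<^sub>R m))) (at_right r)"
proof -
  have 1: "((\<lambda>r. u r - a + (r - t) *\<^sub>R m) has_vector_derivative m - p r) (at_right r)"
    by (rule derivative_eq_intros derivative[OF assms] | simp)+
  show ?thesis
    using bounded_bilinear.has_vector_derivative[OF bounded_bilinear_inner 1 1]
    by (simp add: has_real_derivative_iff_has_vector_derivative inner_commute)
qed

definition minimal_velocity :: "real \<Rightarrow> 'a" where
  "minimal_velocity t = closest_point (support_face K (u t)) 0"

lemma minimal_velocity:
  assumes "0 < t"
  shows "is_arg_min norm (\<lambda>q. q \<in> support_face K (u t)) (minimal_velocity t)"
  unfolding minimal_velocity_def
  using closest_point_is_arg_min support_face_closed_convex(1)[OF polyhedron] inclusion[OF assms]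
  by blast

text \<open>The curve is compared with the line through \<open>u t\<close> with velocity \<open>- m\<close>, where \<open>m\<close> is the minimal
  element. For \<open>r\<close> slightly larger than \<open>t\<close> the velocity \<open>p r\<close> lies in the face exposed by \<open>u t\<close>,
  so \<open>m - p r\<close> is orthogonal to \<open>m\<close>, and the derivative of the squared distance reduces to
  \<open>2 \<langle>m - p r, u r - u t\<rangle>\<close>, which is nonpositive by monotonicity.\<close>

lemma locally_affine:
  assumes t: "0 < t"
  obtains b where "t < b"
    "\<And>s. t \<le> s \<Longrightarrow> s < b \<Longrightarrow> u s = u t - (s - t) *\<^sub>R minimal_velocity t"
    "\<And>s. t \<le> s \<Longrightarrow> s < b \<Longrightarrow> p s \<in> support_face K (u t)"
proof -
  define m where "m = minimal_velocity t"
  have m: "is_arg_min norm (\<lambda>q. q \<in> support_face K (u t)) m"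
    unfolding m_def by (rule minimal_velocity[OF t])
  have "(u \<longlongrightarrow> u t) (at_right t)"
    using has_vector_derivative_continuous[OF derivative[OF t]] by (simp add: continuous_within)
  then have "\<forall>\<^sub>F s in at_right t. support_face K (u s) \<subseteq> support_face K (u t)"
    using inclusion[OF t] by (intro eventually_support_face_subset polyhedron) auto
  then obtain b where b: "t < b" "\<And>s. t < s \<Longrightarrow> s < b \<Longrightarrow> support_face K (u s) \<subseteq> support_face K (u t)"
    by (auto simp: eventually_at_right_field)
  have sub: "p s \<in> support_face K (u t)" if "t \<le> s" "s < b" for s
    using that b(2)[of s] inclusion[of s] t by (cases "s = t") auto
  show thesis
  proof
    fix s assume s: "t \<le> s" "s < b"
    show "p s \<in> support_face K (u t)" using s by (rule sub)
    define g where "g r = (u r - u t + (r - t) *\<^sub>R m) \<bullet> (u r - u t + (r - t) *\<^sub>R m)" for r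
    have "g s \<le> g t + 0 * (s - t)"
    proof (rule right_derivative_upper_bound)
      show "continuous_on {t..s} g"
        unfolding g_def using t
        by (intro continuous_intros continuous_on_subset[OF continuous]) auto
      fix r assume r: "t \<le> r" "r < s"
      then show "(g has_real_derivative 2 * ((m - p r) \<bullet> (u r - u t + (r - t) *\<^sub>R m))) (at_right r)"
        unfolding g_def using t by (intro derivative_sq_dist_affine) auto
      have "0 \<le> (p r - m) \<bullet> (u r - u t)"
        using r t m inclusion[of r]
        by (intro support_face_monotone[of _ K]) (auto simp: is_arg_min_linorder)
      moreover have "(m - p r) \<bullet> m = 0"
        using minimal_element_orthogonalD[OF orthogonal m sub, of r] r s
        by (simp add: inner_diff_left inner_commute[of "p r"])
      ultimately show "2 * ((m - p r) \<bullet> (u r - u t + (r - t) *\<^sub>R m)) \<le> 0"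
        by (simp add: inner_add_right inner_diff_left)
    qed (use s in auto)
    then have "g s \<le> 0" by (simp add: g_def)
    then have "u s - u t + (s - t) *\<^sub>R m = 0" by (metis g_def inner_gt_zero_iff not_less)
    then have "u s - u t = - ((s - t) *\<^sub>R m)" by (simp only: eq_neg_iff_add_eq_0)
    then show "u s = u t - (s - t) *\<^sub>R minimal_velocity t"
      unfolding m_def by (metis diff_add_cancel uminus_add_conv_diff)
  qed (use b in auto)
qed

lemma velocity_eq_minimal_velocity:
  assumes t: "0 < t"
  shows "p t = minimal_velocity t"
proof -
  obtain b where b: "t < b"
    "\<And>s. t \<le> s \<Longrightarrow> s < b \<Longrightarrow> u s = u t - (s - t) *\<^sub>R minimal_velocity t"
    using locally_affine[OF t] by metis
  have "((\<lambda>s. u t - (s - t) *\<^sub>R minimal_velocity t) has_vector_derivative - minimal_velocity t)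
      (at_right t)"
    by (rule derivative_eq_intros | simp)+
  with b have "(u has_vector_derivative - minimal_velocity t) (at_right t)"
    by (rule right_derivative_cong)
  then have "- p t = - minimal_velocity t"
    using derivative[OF t] by (intro vector_derivative_unique_within[of t "{t<..}" u]) auto
  then show ?thesis by simp
qed

lemma velocity_is_eigenvector:
  assumes "0 < t"
  shows "p t \<in> support_face K (p t)"
  using minimal_element_is_eigenvector[OF polyhedron orthogonal minimal_velocity]
    velocity_eq_minimal_velocity assms by simp

lemma finite_velocities: "finite (p ` {0<..})"
proof (rule finite_subset)
  show "p ` {0<..} \<subseteq> (\<lambda>F. closest_point F 0) ` range (support_face K)"
    by (auto simp: velocity_eq_minimal_velocity minimal_velocity_def)
qed (simp add: finite_support_faces polyhedron)

definition energy :: "real \<Rightarrow> real" where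
  "energy t = p t \<bullet> u t"

text \<open>As the inner product with \<open>u t\<close> is maximised by \<open>p t\<close>, the energy is a support function along the
  curve and inherits a Lipschitz estimate from the bound on the velocities, although \<open>p\<close> jumps.\<close>

lemma continuous_energy: "continuous_on {0<..} energy"
  unfolding continuous_on_def
proof
  fix t :: real assume t: "t \<in> {0<..}"
  obtain M where M: "\<And>s. 0 < s \<Longrightarrow> norm (p s) \<le> M"
    using finite_imp_bounded[OF finite_velocities] by (auto simp: bounded_iff)
  have lower: "- M * norm (u s - u r) \<le> energy s - energy r" if "0 < s" "0 < r" for s r
  proof -
    have "p r \<bullet> u s \<le> p s \<bullet> u s"
      using inclusion[OF \<open>0 < s\<close>] inclusion[OF \<open>0 < r\<close>] by (auto simp: support_face_def)
    moreover have "\<bar>p r \<bullet> (u s - u r)\<bar> \<le> M * norm (u s - u r)"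
      by (rule order_trans[OF Cauchy_Schwarz_ineq2]) (intro mult_right_mono M that norm_ge_zero)
    ultimately show ?thesis by (simp add: energy_def inner_diff_right)
  qed
  have "((\<lambda>s. u s - u t) \<longlongrightarrow> 0) (at t within {0<..})"
    using continuous t by (simp add: continuous_on_def LIM_zero)
  moreover have "\<forall>\<^sub>F s in at t within {0<..}. norm (energy s - energy t) \<le> norm (u s - u t) * M"
  proof -
    have "norm (energy s - energy t) \<le> norm (u s - u t) * M" if "0 < s" for s
      using lower[of s t] lower[of t s] t that by (simp add: norm_minus_commute mult.commute abs_le_iff)
    then show ?thesis by (simp add: eventually_at_filter)
  qed
  ultimately have "((\<lambda>s. energy s - energy t) \<longlongrightarrow> 0) (at t within {0<..})"
    by (rule tendsto_0_le)
  then show "(energy \<longlongrightarrow> energy t) (at t within {0<..})" by (rule LIM_zero_cancel)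
qed

lemma energy_derivative:
  assumes t: "0 < t"
  shows "(energy has_real_derivative - (p t \<bullet> p t)) (at_right t)"
  unfolding has_real_derivative_iff_has_vector_derivative
proof -
  obtain b where b: "t < b"
    "\<And>s. t \<le> s \<Longrightarrow> s < b \<Longrightarrow> u s = u t - (s - t) *\<^sub>R minimal_velocity t"
    "\<And>s. t \<le> s \<Longrightarrow> s < b \<Longrightarrow> p s \<in> support_face K (u t)"
    using locally_affine[OF t] by metis
  note min = minimal_velocity[OF t, folded velocity_eq_minimal_velocity[OF t]]
  have "energy s = energy t - (s - t) * (p t \<bullet> p t)" if s: "t \<le> s" "s < b" for s
  proof -
    have "p t \<bullet> p s = p t \<bullet> p t"
      by (rule minimal_element_orthogonalD[OF orthogonal min b(3)[OF s]])
    moreover have "p s \<bullet> u t = p t \<bullet> u t"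
      using b(3)[OF s] inclusion[OF t] by (auto simp: support_face_def intro: antisym)
    ultimately show ?thesis
      using b(2)[OF s]
      by (simp add: energy_def inner_diff_right velocity_eq_minimal_velocity[OF t] inner_commute)
  qed
  with b(1) show "(energy has_vector_derivative - (p t \<bullet> p t)) (at_right t)"
  proof (rule right_derivative_cong)
    show "((\<lambda>s. energy t - (s - t) * (p t \<bullet> p t)) has_vector_derivative - (p t \<bullet> p t)) (at_right t)"
      by (rule derivative_eq_intros | simp)+
  qed
qed

text \<open>If \<open>p T = 0\<close>, then zero belongs to the face exposed by \<open>u T\<close>, so by monotonicity the distance of
  \<open>u\<close> to \<open>u T\<close> cannot grow after \<open>T\<close>.\<close>

lemma stationary_after_zero_velocity:
  assumes T: "0 < T" "p T = 0" and s: "T \<le> s"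
  shows "p s = 0"
proof -
  \<comment> \<open>The zero summand makes this an instance of the derivative formula with \<open>m = 0\<close>.\<close>
  define g where "g r = (u r - u T + (r - T) *\<^sub>R 0) \<bullet> (u r - u T + (r - T) *\<^sub>R 0)" for r
  have "g s \<le> g T + 0 * (s - T)"
  proof (rule right_derivative_upper_bound)
    show "continuous_on {T..s} g"
      unfolding g_def using T
      by (intro continuous_intros continuous_on_subset[OF continuous]) auto
    fix r assume r: "T \<le> r" "r < s"
    then show "(g has_real_derivative 2 * ((0 - p r) \<bullet> (u r - u T + (r - T) *\<^sub>R 0))) (at_right r)"
      unfolding g_def using T by (intro derivative_sq_dist_affine) auto
    have "0 \<le> (p r - p T) \<bullet> (u r - u T)"
      using r T by (intro support_face_monotone[of _ K] inclusion) auto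
    then show "2 * ((0 - p r) \<bullet> (u r - u T + (r - T) *\<^sub>R 0)) \<le> 0" using T by simp
  qed (use s in auto)
  then have "(u s - u T) \<bullet> (u s - u T) \<le> 0" by (simp add: g_def)
  then have "u s = u T" by (metis eq_iff_diff_eq_0 inner_gt_zero_iff not_less)
  then show ?thesis
    using velocity_eq_minimal_velocity[of s] velocity_eq_minimal_velocity[of T] T s
    by (simp add: minimal_velocity_def)
qed

lemma finite_extinction_time:
  assumes sym: "\<And>q. q \<in> K \<Longrightarrow> - q \<in> K"
  obtains T where "0 < T" "\<And>t. T \<le> t \<Longrightarrow> p t = 0"
proof -
  have nonneg: "0 \<le> energy t" if "0 < t" for t
  proof -
    have "(- p t) \<bullet> u t \<le> p t \<bullet> u t"
      using inclusion[OF that] sym by (auto simp: support_face_def simp del: inner_minus_left)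
    then show ?thesis by (simp add: energy_def)
  qed
  have "\<exists>T>0. p T = 0"
  proof (rule ccontr)
    assume "\<not> ?thesis"
    then have ne: "p t \<noteq> 0" if "0 < t" for t :: real using that by blast
    define c where "c = Min ((\<lambda>q. q \<bullet> q) ` p ` {0<..})"
    have fin: "finite ((\<lambda>q. q \<bullet> q) ` p ` {0<..})" using finite_velocities by simp
    have c: "0 < c" "\<And>t. 0 < t \<Longrightarrow> c \<le> p t \<bullet> p t"
      using fin ne by (auto simp: c_def)
    \<comment> \<open>After time \<open>l\<close> a decrease at rate \<open>c\<close> has taken the energy from \<open>energy 1\<close> to at most \<open>- 1\<close>.\<close>
    define l where "l = (energy 1 + 1) / c"
    have l: "0 \<le> l" using nonneg[of 1] c by (simp add: l_def)
    have "energy (1 + l) \<le> energy 1 + (- c) * (1 + l - 1)"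
    proof (rule right_derivative_upper_bound)
      show "continuous_on {1..1 + l} energy" by (rule continuous_on_subset[OF continuous_energy]) auto
      fix t :: real assume "1 \<le> t"
      then show "(energy has_real_derivative - (p t \<bullet> p t)) (at_right t)" "- (p t \<bullet> p t) \<le> - c"
        using energy_derivative[of t] c(2)[of t] by auto
    qed (use l in auto)
    also have "\<dots> = - 1" using c by (simp add: l_def)
    finally show False using nonneg[of "1 + l"] l by simp
  qed
  then show ?thesis using that stationary_after_zero_velocity by blast
qed

end

theorem theorem5p1:
  fixes J :: "real ^ 'n \<Rightarrow> ereal" and f :: "real ^ 'n" and u p :: "real \<Rightarrow> real ^ 'n"
  assumes "J \<in> class_C"
    and "polyhedron (subdiff J 0)"
    and "\<And>w p\<^sub>0. is_arg_min norm (\<lambda>q. q \<in> subdiff J w) p\<^sub>0 \<Longrightarrow> \<forall>q\<in>subdiff J w. p\<^sub>0 \<bullet> (p\<^sub>0 - q) = 0"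
    and "f \<in> closure (dom_subdiff J)"
    and "gradient_flow J f u p"
  shows "(\<forall>t>0. p t \<in> subdiff J (p t)) \<and>
         finite (p ` {0<..}) \<and>
         (\<exists>T>0. \<forall>t\<ge>T. p t = 0)"
proof -
  note face = subdiff_eq_support_face[OF assms(1)]
  interpret polyhedral_flow "subdiff J 0" u p
  proof
    show "minimal_elements_orthogonal (subdiff J 0)"
      using assms(3) unfolding minimal_elements_orthogonal_def face[symmetric] by blast
    show "continuous_on {0<..} u"
      using assms(5) by (auto simp: gradient_flow_def intro: continuous_on_subset)
    fix t :: real assume "0 < t"
    then show "(u has_vector_derivative - p t) (at_right t)"
      and "p t \<in> support_face (subdiff J 0) (u t)"
      using assms(5) unfolding gradient_flow_def face[symmetric] by auto
  qed (rule assms(2))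
  obtain T where "0 < T" "\<And>t. T \<le> t \<Longrightarrow> p t = 0"
    using finite_extinction_time uminus_mem_subdiff_0[OF assms(1)] by metis
  then show ?thesis
    using velocity_is_eigenvector finite_velocities unfolding face[symmetric] by blast
qed

end
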